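(* Let $I$ be an ideal of $\overline{\mathbb{R}}$. Then $r_{\overline{\mathbb{R}}}(I)\neq (0)$ if and only if there exists an idempotent $e\in\overline{\mathbb{R}}$, $e\neq 1$, such that $I\subseteq \overline{\mathbb{R}}e$. Equivalently, $I$ is essential if and only if there is no idempotent $e\neq 1$ of $\overline{\mathbb{R}}$ with $I\subseteq\overline{\mathbb{R}}e$. Moreover, if $r_{\overline{\mathbb{R}}}(I)\neq (0)$, then $r_{\overline{\mathbb{R}}}(I)$ contains a nonzero idempotent of $\overline{\mathbb{R}}$.
   Context: Let $\mathbf{I}=\,]0,1]$. A function $\hat x:\mathbf{I}\to\mathbb{R}$ is moderate if there is $a\in\mathbb{R}$ with $\lim_{\varepsilon\to 0}|\hat x(\varepsilon)|/\varepsilon^{a}=0$, and null if this limit is $0$ for all $a\in\mathbb{R}$. The moderate functions form a ring under pointwise operations, the null functions form an ideal in it, and $\overline{\mathbb{R}}$ (the ring of Colombeau generalized real numbers) is the quotient ring. For an ideal $I$ of $\overline{\mathbb{R}}$, $r_{\overline{\mathbb{R}}}(I)=\{x\in\overline{\mathbb{R}} : yx=0\ \forall y\in I\}$ is its annihilator. An ideal is essential if it has nonzero intersection with every nonzero ideal of $\overline{\mathbb{R}}$. *)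

theory Defs
  imports Complex_Main "HOL-Algebra.QuotRing" "HOL-Library.FuncSet"
begin

abbreviation I01 :: "real set" where
  "I01 \<equiv> {0<..1}"

definition moderate :: "(real \<Rightarrow> real) \<Rightarrow> bool" where
  "moderate x \<longleftrightarrow>
    (\<exists>a::real. ((\<lambda>\<epsilon>. \<bar>x \<epsilon>\<bar> / \<epsilon> powr a) \<longlongrightarrow> 0) (at 0 within I01))"

definition null_fun :: "(real \<Rightarrow> real) \<Rightarrow> bool" where
  "null_fun x \<longleftrightarrow>
    (\<forall>a::real. ((\<lambda>\<epsilon>. \<bar>x \<epsilon>\<bar> / \<epsilon> powr a) \<longlongrightarrow> 0) (at 0 within I01))"

text \<open>Functions with domain \<open>]0,1]\<close> are represented by \<^const>\<open>extensional\<close> functions, so the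
  operations are the pointwise ones restricted to \<open>]0,1]\<close>.\<close>

definition moderate_ring :: "(real \<Rightarrow> real) ring" where
  "moderate_ring =
    \<lparr>carrier = {x \<in> extensional I01. moderate x},
     monoid.mult = (\<lambda>x y. \<lambda>\<epsilon>\<in>I01. x \<epsilon> * y \<epsilon>),
     one = (\<lambda>\<epsilon>\<in>I01. 1),
     zero = (\<lambda>\<epsilon>\<in>I01. 0),
     add = (\<lambda>x y. \<lambda>\<epsilon>\<in>I01. x \<epsilon> + y \<epsilon>)\<rparr>"

definition null_ideal :: "(real \<Rightarrow> real) set" where
  "null_ideal = {x \<in> extensional I01. null_fun x}"

definition colombeau_reals :: "(real \<Rightarrow> real) set ring" where
  "colombeau_reals = moderate_ring Quot null_ideal"

definition annihilator :: "('a, 'b) ring_scheme \<Rightarrow> 'a set \<Rightarrow> 'a set" where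
  "annihilator R I = {x \<in> carrier R. \<forall>y\<in>I. y \<otimes>\<^bsub>R\<^esub> x = \<zero>\<^bsub>R\<^esub>}"

definition idempotent_elem :: "('a, 'b) ring_scheme \<Rightarrow> 'a \<Rightarrow> bool" where
  "idempotent_elem R e \<longleftrightarrow> e \<in> carrier R \<and> e \<otimes>\<^bsub>R\<^esub> e = e"

definition essential_ideal :: "('a, 'b) ring_scheme \<Rightarrow> 'a set \<Rightarrow> bool" where
  "essential_ideal R I \<longleftrightarrow>
    ideal I R \<and> (\<forall>J. ideal J R \<and> J \<noteq> {\<zero>\<^bsub>R\<^esub>} \<longrightarrow> I \<inter> J \<noteq> {\<zero>\<^bsub>R\<^esub>})"

text \<open>The predicate \<^const>\<open>ideal\<close> includes that the ambient structure is a ring; the following facts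
  show that the construction indeed yields a nontrivial commutative ring.\<close>

lemma powr_tendsto_zero:
  assumes "0 < (c::real)"
  shows "((\<lambda>\<epsilon>. \<epsilon> powr c) \<longlongrightarrow> 0) (at 0 within I01)"
proof -
  have "((\<lambda>\<epsilon>::real. \<epsilon> powr c) \<longlongrightarrow> 0 powr c) (at 0 within I01)"
    by (rule tendsto_powr'[OF tendsto_ident_at tendsto_const])
      (use assms in \<open>auto simp: eventually_at_filter\<close>)
  then show ?thesis by simp
qed

lemma null_comparison:
  fixes f g :: "real \<Rightarrow> real"
  assumes "\<And>\<epsilon>. \<epsilon> \<in> I01 \<Longrightarrow> \<bar>f \<epsilon>\<bar> \<le> g \<epsilon>" and "(g \<longlongrightarrow> 0) (at 0 within I01)"
  shows "(f \<longlongrightarrow> 0) (at 0 within I01)"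
proof (rule tendsto_0_le[where K = 1, OF assms(2)])
  show "\<forall>\<^sub>F \<epsilon> in at 0 within I01. norm (f \<epsilon>) \<le> norm (g \<epsilon>) * 1"
    unfolding eventually_at_filter using assms(1) by (force intro!: always_eventually)
qed

lemma order_mono:
  assumes "((\<lambda>\<epsilon>. \<bar>x \<epsilon>\<bar> / \<epsilon> powr a) \<longlongrightarrow> 0) (at (0::real) within I01)" and "b \<le> a"
  shows "((\<lambda>\<epsilon>. \<bar>x \<epsilon>\<bar> / \<epsilon> powr b) \<longlongrightarrow> (0::real)) (at 0 within I01)"
proof (rule null_comparison[OF _ assms(1)])
  fix \<epsilon> :: real assume \<epsilon>: "\<epsilon> \<in> I01"
  then have "\<epsilon> powr a \<le> \<epsilon> powr b" using assms(2) by (intro powr_mono') auto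
  then show "\<bar>\<bar>x \<epsilon>\<bar> / \<epsilon> powr b\<bar> \<le> \<bar>x \<epsilon>\<bar> / \<epsilon> powr a"
    using \<epsilon> by (auto intro!: divide_left_mono)
qed

lemma order_add:
  assumes "((\<lambda>\<epsilon>. \<bar>x \<epsilon>\<bar> / \<epsilon> powr a) \<longlongrightarrow> 0) (at (0::real) within I01)"
    and "((\<lambda>\<epsilon>. \<bar>y \<epsilon>\<bar> / \<epsilon> powr a) \<longlongrightarrow> 0) (at (0::real) within I01)"
  shows "((\<lambda>\<epsilon>. \<bar>(\<lambda>\<epsilon>\<in>I01. x \<epsilon> + y \<epsilon>) \<epsilon>\<bar> / \<epsilon> powr a) \<longlongrightarrow> (0::real)) (at 0 within I01)"
proof (rule null_comparison)
  show "((\<lambda>\<epsilon>. \<bar>x \<epsilon>\<bar> / \<epsilon> powr a + \<bar>y \<epsilon>\<bar> / \<epsilon> powr a) \<longlongrightarrow> (0::real)) (at 0 within I01)"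
    using tendsto_add[OF assms] by simp
qed (auto simp: add_divide_distrib[symmetric] intro!: divide_right_mono)

lemma order_mult:
  assumes "((\<lambda>\<epsilon>. \<bar>x \<epsilon>\<bar> / \<epsilon> powr a) \<longlongrightarrow> 0) (at (0::real) within I01)"
    and "((\<lambda>\<epsilon>. \<bar>y \<epsilon>\<bar> / \<epsilon> powr b) \<longlongrightarrow> 0) (at (0::real) within I01)"
  shows "((\<lambda>\<epsilon>. \<bar>(\<lambda>\<epsilon>\<in>I01. x \<epsilon> * y \<epsilon>) \<epsilon>\<bar> / \<epsilon> powr (a + b)) \<longlongrightarrow> (0::real)) (at 0 within I01)"
proof (rule null_comparison)
  show "((\<lambda>\<epsilon>. (\<bar>x \<epsilon>\<bar> / \<epsilon> powr a) * (\<bar>y \<epsilon>\<bar> / \<epsilon> powr b)) \<longlongrightarrow> (0::real)) (at 0 within I01)"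
    using tendsto_mult[OF assms] by simp
qed (auto simp: abs_mult powr_add)

lemma order_uminus:
  assumes "((\<lambda>\<epsilon>. \<bar>x \<epsilon>\<bar> / \<epsilon> powr a) \<longlongrightarrow> 0) (at (0::real) within I01)"
  shows "((\<lambda>\<epsilon>. \<bar>(\<lambda>\<epsilon>\<in>I01. - x \<epsilon>) \<epsilon>\<bar> / \<epsilon> powr a) \<longlongrightarrow> (0::real)) (at 0 within I01)"
  by (rule null_comparison[OF _ assms]) auto

lemma order_zero:
  "((\<lambda>\<epsilon>. \<bar>(\<lambda>\<epsilon>\<in>I01. 0) \<epsilon>\<bar> / \<epsilon> powr a) \<longlongrightarrow> (0::real)) (at (0::real) within I01)"
  by (rule null_comparison[OF _ tendsto_const]) auto

lemma moderate_add:
  assumes "moderate x" "moderate y"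
  shows "moderate (\<lambda>\<epsilon>\<in>I01. x \<epsilon> + y \<epsilon>)"
proof -
  obtain a b where
    a: "((\<lambda>\<epsilon>. \<bar>x \<epsilon>\<bar> / \<epsilon> powr a) \<longlongrightarrow> 0) (at 0 within I01)" and
    b: "((\<lambda>\<epsilon>. \<bar>y \<epsilon>\<bar> / \<epsilon> powr b) \<longlongrightarrow> 0) (at 0 within I01)"
    using assms by (auto simp: moderate_def)
  have "((\<lambda>\<epsilon>. \<bar>(\<lambda>\<epsilon>\<in>I01. x \<epsilon> + y \<epsilon>) \<epsilon>\<bar> / \<epsilon> powr min a b) \<longlongrightarrow> 0) (at 0 within I01)"
    by (rule order_add[OF order_mono[OF a] order_mono[OF b]]) auto
  then show ?thesis unfolding moderate_def by (rule exI)
qed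

lemma moderate_mult:
  assumes "moderate x" "moderate y"
  shows "moderate (\<lambda>\<epsilon>\<in>I01. x \<epsilon> * y \<epsilon>)"
proof -
  obtain a b where
    "((\<lambda>\<epsilon>. \<bar>x \<epsilon>\<bar> / \<epsilon> powr a) \<longlongrightarrow> 0) (at 0 within I01)"
    "((\<lambda>\<epsilon>. \<bar>y \<epsilon>\<bar> / \<epsilon> powr b) \<longlongrightarrow> 0) (at 0 within I01)"
    using assms by (auto simp: moderate_def)
  from order_mult[OF this] show ?thesis unfolding moderate_def by (rule exI)
qed

lemma moderate_uminus:
  assumes "moderate x"
  shows "moderate (\<lambda>\<epsilon>\<in>I01. - x \<epsilon>)"
proof -
  obtain a where "((\<lambda>\<epsilon>. \<bar>x \<epsilon>\<bar> / \<epsilon> powr a) \<longlongrightarrow> 0) (at 0 within I01)"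
    using assms by (auto simp: moderate_def)
  from order_uminus[OF this] show ?thesis unfolding moderate_def by (rule exI)
qed

lemma moderate_zero: "moderate (\<lambda>\<epsilon>\<in>I01. 0)"
  unfolding moderate_def by (rule exI[of _ 0], rule order_zero)

lemma moderate_one: "moderate (\<lambda>\<epsilon>\<in>I01. 1)"
  unfolding moderate_def
proof (rule exI)
  show "((\<lambda>\<epsilon>. \<bar>(\<lambda>\<epsilon>\<in>I01. 1) \<epsilon>\<bar> / \<epsilon> powr (-1)) \<longlongrightarrow> (0::real)) (at (0::real) within I01)"
    by (rule null_comparison[OF _ powr_tendsto_zero[of 1]])
      (auto simp: powr_minus divide_simps)
qed

lemma null_fun_add:
  "null_fun x \<Longrightarrow> null_fun y \<Longrightarrow> null_fun (\<lambda>\<epsilon>\<in>I01. x \<epsilon> + y \<epsilon>)"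
  unfolding null_fun_def by (intro allI order_add) (erule spec)+

lemma null_fun_uminus: "null_fun x \<Longrightarrow> null_fun (\<lambda>\<epsilon>\<in>I01. - x \<epsilon>)"
  unfolding null_fun_def by (intro allI order_uminus) (erule spec)

lemma null_fun_zero: "null_fun (\<lambda>\<epsilon>\<in>I01. 0)"
  unfolding null_fun_def by (intro allI order_zero)

lemma null_fun_mult:
  assumes "moderate y" "null_fun x"
  shows "null_fun (\<lambda>\<epsilon>\<in>I01. y \<epsilon> * x \<epsilon>)"
  unfolding null_fun_def
proof
  fix a
  obtain b where b: "((\<lambda>\<epsilon>. \<bar>y \<epsilon>\<bar> / \<epsilon> powr b) \<longlongrightarrow> 0) (at 0 within I01)"
    using assms(1) unfolding moderate_def by blast
  have "((\<lambda>\<epsilon>. \<bar>x \<epsilon>\<bar> / \<epsilon> powr (a - b)) \<longlongrightarrow> 0) (at 0 within I01)"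
    using assms(2) unfolding null_fun_def by blast
  from order_mult[OF b this]
  show "((\<lambda>\<epsilon>. \<bar>(\<lambda>\<epsilon>\<in>I01. y \<epsilon> * x \<epsilon>) \<epsilon>\<bar> / \<epsilon> powr a) \<longlongrightarrow> 0) (at 0 within I01)"
    by (simp only: add_diff_eq add_diff_cancel_left')
qed

lemma null_fun_imp_moderate: "null_fun x \<Longrightarrow> moderate x"
  unfolding null_fun_def moderate_def by blast

lemma cring_moderate_ring: "cring moderate_ring"
proof (rule cringI)
  show "abelian_group moderate_ring"
  proof (rule abelian_groupI)
    fix x assume x: "x \<in> carrier moderate_ring"
    show "\<exists>y\<in>carrier moderate_ring. y \<oplus>\<^bsub>moderate_ring\<^esub> x = \<zero>\<^bsub>moderate_ring\<^esub>"
    proof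
      show "(\<lambda>\<epsilon>\<in>I01. - x \<epsilon>) \<in> carrier moderate_ring"
        using x by (simp add: moderate_ring_def moderate_uminus)
      show "(\<lambda>\<epsilon>\<in>I01. - x \<epsilon>) \<oplus>\<^bsub>moderate_ring\<^esub> x = \<zero>\<^bsub>moderate_ring\<^esub>"
        unfolding moderate_ring_def by (simp cong: restrict_cong)
    qed
    show "\<zero>\<^bsub>moderate_ring\<^esub> \<oplus>\<^bsub>moderate_ring\<^esub> x = x"
      using x unfolding moderate_ring_def
      by (simp add: extensional_restrict cong: restrict_cong)
  qed (simp_all add: moderate_ring_def moderate_add moderate_zero add_ac cong: restrict_cong)
  show "Group.comm_monoid moderate_ring"
  proof (rule comm_monoidI)
    fix x assume x: "x \<in> carrier moderate_ring"
    show "\<one>\<^bsub>moderate_ring\<^esub> \<otimes>\<^bsub>moderate_ring\<^esub> x = x"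
      using x unfolding moderate_ring_def
      by (simp add: extensional_restrict cong: restrict_cong)
  qed (simp_all add: moderate_ring_def moderate_mult moderate_one mult_ac cong: restrict_cong)
qed (simp add: moderate_ring_def distrib_right cong: restrict_cong)

lemma ideal_null_ideal: "ideal null_ideal moderate_ring"
proof -
  interpret cring moderate_ring by (rule cring_moderate_ring)
  have sub: "null_ideal \<subseteq> carrier moderate_ring"
    by (auto simp: null_ideal_def moderate_ring_def null_fun_imp_moderate)
  have inv: "\<ominus>\<^bsub>moderate_ring\<^esub> x = (\<lambda>\<epsilon>\<in>I01. - x \<epsilon>)" if "x \<in> carrier moderate_ring" for x
  proof (rule minus_equality)
    show "(\<lambda>\<epsilon>\<in>I01. - x \<epsilon>) \<oplus>\<^bsub>moderate_ring\<^esub> x = \<zero>\<^bsub>moderate_ring\<^esub>"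
      unfolding moderate_ring_def by (simp cong: restrict_cong)
    show "(\<lambda>\<epsilon>\<in>I01. - x \<epsilon>) \<in> carrier moderate_ring"
      using that by (simp add: moderate_ring_def moderate_uminus)
  qed (rule that)
  have mult: "y \<otimes>\<^bsub>moderate_ring\<^esub> x \<in> null_ideal"
    if x: "x \<in> null_ideal" and y: "y \<in> carrier moderate_ring" for x y
    using x y by (simp add: null_ideal_def moderate_ring_def null_fun_mult)
  show ?thesis
  proof (rule idealI[OF ring_axioms])
    show "subgroup null_ideal (add_monoid moderate_ring)"
    proof (rule add.subgroupI)
      show "null_ideal \<noteq> {}"
        using null_fun_zero restrict_extensional unfolding null_ideal_def by blast
    next
      fix x assume x: "x \<in> null_ideal"
      then have "\<ominus>\<^bsub>moderate_ring\<^esub> x = (\<lambda>\<epsilon>\<in>I01. - x \<epsilon>)" using sub inv by auto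
      then show "\<ominus>\<^bsub>moderate_ring\<^esub> x \<in> null_ideal"
        using x by (simp add: null_ideal_def null_fun_uminus)
    next
      fix x y assume "x \<in> null_ideal" "y \<in> null_ideal"
      then show "x \<oplus>\<^bsub>moderate_ring\<^esub> y \<in> null_ideal"
        by (simp add: null_ideal_def moderate_ring_def null_fun_add)
    qed (use sub in auto)
  next
    fix a x assume a: "a \<in> null_ideal" and x: "x \<in> carrier moderate_ring"
    show "x \<otimes>\<^bsub>moderate_ring\<^esub> a \<in> null_ideal" by (rule mult[OF a x])
    then show "a \<otimes>\<^bsub>moderate_ring\<^esub> x \<in> null_ideal"
      using m_comm[of a x] a x sub by (simp add: subset_iff)
  qed
qed

lemma cring_colombeau_reals: "cring colombeau_reals"
  unfolding colombeau_reals_def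
  by (rule ideal.quotient_is_cring[OF ideal_null_ideal cring_moderate_ring])

lemma colombeau_reals_one_not_zero: "\<one>\<^bsub>colombeau_reals\<^esub> \<noteq> \<zero>\<^bsub>colombeau_reals\<^esub>"
proof
  interpret ideal null_ideal moderate_ring by (rule ideal_null_ideal)
  assume "\<one>\<^bsub>colombeau_reals\<^esub> = \<zero>\<^bsub>colombeau_reals\<^esub>"
  then have "\<one>\<^bsub>moderate_ring\<^esub> \<in> null_ideal"
    by (auto simp: colombeau_reals_def FactRing_def intro: a_coset_join1[OF _ one_closed a_subgroup])
  then have "((\<lambda>\<epsilon>. \<bar>(\<lambda>\<epsilon>\<in>I01. 1) \<epsilon>\<bar> / \<epsilon> powr 0) \<longlongrightarrow> (0::real)) (at (0::real) within I01)"
    by (simp only: null_ideal_def null_fun_def moderate_ring_def ring.simps monoid.simps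
        mem_Collect_eq)
  moreover have "\<forall>\<^sub>F \<epsilon> in at 0 within I01. \<bar>(\<lambda>\<epsilon>\<in>I01. 1) \<epsilon>\<bar> / \<epsilon> powr 0 = (1::real)"
    by (auto simp: eventually_at_filter)
  ultimately have "((\<lambda>\<epsilon>. 1) \<longlongrightarrow> (0::real)) (at (0::real) within I01)"
    by (rule Lim_transform_eventually)
  moreover have "at (0::real) within I01 \<noteq> bot"
  proof -
    have "at (0::real) within I01 = at_right 0"
      by (rule at_within_nhd[of _ "{..<1}"]) auto
    then show ?thesis by simp
  qed
  ultimately show False by (simp add: tendsto_const_iff)
qed

end

theory Submission
  imports Defs
begin

text \<open>
  The quotient ring has a strong regularity property: every nonzero element \<open>x\<close> has a multiple that
  is a nonzero idempotent.  Indeed, a representative of \<open>x\<close> that is not null satisfies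
  \<open>\<bar>x \<epsilon>\<bar> \<ge> \<delta> * \<epsilon> powr a\<close> on a set \<open>S\<close> of parameters accumulating at \<open>0\<close>.  On \<open>S\<close> the pointwise inverse
  of \<open>x\<close> is bounded by a power of \<open>\<epsilon>\<close>, so extending it by \<open>0\<close> gives a moderate function, whose product
  with \<open>x\<close> is the characteristic function of \<open>S\<close>.  That function is idempotent, and it is not null
  because \<open>S\<close> accumulates at \<open>0\<close> (\<open>colombeau_reals_idempotent_multiple\<close>).

  The rest is pure algebra and holds in every commutative ring with this property.  A nonzero element
  of the annihilator of \<open>I\<close> has a nonzero idempotent multiple \<open>e\<close>, again in the annihilator, and
  \<open>I\<close> annihilated by \<open>e\<close> means the same as \<open>I\<close> contained in the principal ideal of the idempotent
  \<open>1 - e\<close>.  Finally the ring is reduced, so \<open>I\<close> meets its annihilator only in \<open>0\<close>, which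
  makes essential ideals the same as ideals with zero annihilator.
\<close>

section \<open>Commutative rings in which nonzero elements have idempotent multiples\<close>

context cring
begin

lemma idempotent_complement:
  assumes "idempotent_elem R e"
  shows "idempotent_elem R (\<one> \<ominus> e)"
proof -
  have e: "e \<in> carrier R" "e \<otimes> e = e"
    using assms by (auto simp: idempotent_elem_def)
  have "(\<one> \<ominus> e) \<otimes> (\<one> \<ominus> e) = \<one> \<ominus> e \<ominus> e \<oplus> e \<otimes> e"
    using e(1) by algebra
  also have "\<dots> = \<one> \<ominus> e"
    unfolding e(2) using e(1) by algebra
  finally show ?thesis
    using e(1) by (simp add: idempotent_elem_def)
qed

text \<open>The Peirce decomposition \<open>x = x \<otimes> (\<one> \<ominus> e) \<oplus> x \<otimes> e\<close> exhibits \<open>x\<close> as a multiple of \<open>e\<close> as soon as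
  its first summand vanishes.\<close>

lemma mem_PIdl_idempotent_iff:
  assumes "idempotent_elem R e" and x: "x \<in> carrier R"
  shows "x \<in> PIdl e \<longleftrightarrow> x \<otimes> (\<one> \<ominus> e) = \<zero>"
proof -
  have e: "e \<in> carrier R" "e \<otimes> e = e"
    using assms by (auto simp: idempotent_elem_def)
  show ?thesis
  proof
    assume "x \<in> PIdl e"
    then obtain r where r: "r \<in> carrier R" "x = r \<otimes> e"
      by (auto simp: cgenideal_def)
    have "x \<otimes> (\<one> \<ominus> e) = r \<otimes> e \<ominus> r \<otimes> (e \<otimes> e)"
      unfolding r(2) using e(1) r(1) by algebra
    also have "\<dots> = \<zero>"
      unfolding e(2) using e(1) r(1) by algebra
    finally show "x \<otimes> (\<one> \<ominus> e) = \<zero>" .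
  next
    assume z: "x \<otimes> (\<one> \<ominus> e) = \<zero>"
    have "x = x \<otimes> (\<one> \<ominus> e) \<oplus> x \<otimes> e"
      using e(1) x by algebra
    also have "\<dots> = x \<otimes> e"
      unfolding z using e(1) x by simp
    finally show "x \<in> PIdl e"
      using x by (auto simp: cgenideal_def)
  qed
qed

lemma subset_PIdl_idempotent_iff:
  assumes "idempotent_elem R e" and "I \<subseteq> carrier R"
  shows "I \<subseteq> PIdl e \<longleftrightarrow> \<one> \<ominus> e \<in> annihilator R I"
proof -
  have "e \<in> carrier R"
    using assms(1) by (simp add: idempotent_elem_def)
  moreover have "x \<in> PIdl e \<longleftrightarrow> x \<otimes> (\<one> \<ominus> e) = \<zero>" if "x \<in> I" for x
    using mem_PIdl_idempotent_iff[OF assms(1)] that assms(2) by blast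
  ultimately show ?thesis
    by (auto simp: annihilator_def)
qed

lemma annihilator_ideal:
  assumes "I \<subseteq> carrier R"
  shows "ideal (annihilator R I) R"
proof (rule idealI[OF ring_axioms])
  show "subgroup (annihilator R I) (add_monoid R)"
  proof (rule add.subgroupI)
    have "\<zero> \<in> annihilator R I"
      using assms by (auto simp: annihilator_def)
    then show "annihilator R I \<noteq> {}"
      by blast
  next
    fix a assume a: "a \<in> annihilator R I"
    have "y \<otimes> (\<ominus> a) = \<zero>" if "y \<in> I" for y
      using a that assms by (simp add: annihilator_def r_minus subsetD)
    then show "\<ominus> a \<in> annihilator R I"
      using a by (simp add: annihilator_def)
  next
    fix a b assume ab: "a \<in> annihilator R I" "b \<in> annihilator R I"
    have "y \<otimes> (a \<oplus> b) = \<zero>" if "y \<in> I" for y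
      using ab that assms by (simp add: annihilator_def r_distr subsetD)
    then show "a \<oplus> b \<in> annihilator R I"
      using ab by (simp add: annihilator_def)
  qed (auto simp: annihilator_def)
next
  fix a x assume a: "a \<in> annihilator R I" and x: "x \<in> carrier R"
  have "y \<otimes> (x \<otimes> a) = \<zero>" if "y \<in> I" for y
  proof -
    have y: "y \<in> carrier R" "a \<in> carrier R" "y \<otimes> a = \<zero>"
      using a that assms by (auto simp: annihilator_def)
    then have "y \<otimes> (x \<otimes> a) = x \<otimes> (y \<otimes> a)"
      using x by (simp add: m_lcomm)
    then show ?thesis
      using x y by simp
  qed
  then show "x \<otimes> a \<in> annihilator R I"
    using a x by (auto simp: annihilator_def)
  then show "a \<otimes> x \<in> annihilator R I"
    using a x by (simp add: annihilator_def m_comm)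
qed

end

text \<open>
  A weak form of von Neumann regularity: \<open>y\<close> inverts \<open>x\<close> on a nonzero direct factor of the ring, the
  one cut out by the idempotent \<open>y \<otimes> x\<close>.
\<close>

locale idempotent_multiple_cring = cring +
  assumes idempotent_multiple:
    "\<lbrakk>x \<in> carrier R; x \<noteq> \<zero>\<rbrakk> \<Longrightarrow>
      \<exists>y\<in>carrier R. idempotent_elem R (y \<otimes> x) \<and> y \<otimes> x \<noteq> \<zero>"
begin

text \<open>If \<open>y \<otimes> x\<close> is idempotent, it equals its own square, which is a multiple of \<open>x \<otimes> x\<close>.\<close>

lemma square_zero_imp_zero:
  assumes x: "x \<in> carrier R" and sq: "x \<otimes> x = \<zero>"
  shows "x = \<zero>"
proof (rule ccontr)
  assume "x \<noteq> \<zero>"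
  then obtain y where y: "y \<in> carrier R" "idempotent_elem R (y \<otimes> x)" "y \<otimes> x \<noteq> \<zero>"
    using idempotent_multiple x by blast
  have "y \<otimes> x = (y \<otimes> x) \<otimes> (y \<otimes> x)"
    using y(2) by (simp add: idempotent_elem_def)
  also have "\<dots> = (y \<otimes> y) \<otimes> (x \<otimes> x)"
    using x y(1) by algebra
  also have "\<dots> = \<zero>"
    using y(1) sq by simp
  finally show False
    using y(3) by simp
qed

lemma annihilator_contains_idempotent:
  assumes "I \<subseteq> carrier R" and "annihilator R I \<noteq> {\<zero>}"
  shows "\<exists>e\<in>annihilator R I. idempotent_elem R e \<and> e \<noteq> \<zero>"
proof -
  interpret A: ideal "annihilator R I" R
    by (rule annihilator_ideal[OF assms(1)])
  obtain x where x: "x \<in> annihilator R I" "x \<noteq> \<zero>"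
    using assms(2) A.zero_closed by blast
  then obtain y where "y \<in> carrier R" "idempotent_elem R (y \<otimes> x)" "y \<otimes> x \<noteq> \<zero>"
    using idempotent_multiple A.Icarr by blast
  then show ?thesis
    using A.I_l_closed x(1) by blast
qed

lemma annihilator_nonzero_iff:
  assumes "I \<subseteq> carrier R"
  shows "annihilator R I \<noteq> {\<zero>} \<longleftrightarrow> (\<exists>e. idempotent_elem R e \<and> e \<noteq> \<one> \<and> I \<subseteq> PIdl e)"
proof
  assume "annihilator R I \<noteq> {\<zero>}"
  then obtain e where e: "e \<in> annihilator R I" "idempotent_elem R e" "e \<noteq> \<zero>"
    using annihilator_contains_idempotent[OF assms] by blast
  have ec: "e \<in> carrier R"
    using e(2) by (simp add: idempotent_elem_def)
  then have dc: "\<one> \<ominus> (\<one> \<ominus> e) = e"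
    by algebra
  have "\<one> \<ominus> e \<noteq> \<one>"
  proof
    assume "\<one> \<ominus> e = \<one>"
    with dc have "e = \<one> \<ominus> \<one>"
      by simp
    with e(3) show False
      by (simp add: a_minus_def r_neg)
  qed
  moreover have "I \<subseteq> PIdl (\<one> \<ominus> e)"
    using subset_PIdl_idempotent_iff[OF idempotent_complement[OF e(2)] assms] dc e(1) by simp
  ultimately show "\<exists>e. idempotent_elem R e \<and> e \<noteq> \<one> \<and> I \<subseteq> PIdl e"
    using idempotent_complement[OF e(2)] by blast
next
  assume "\<exists>e. idempotent_elem R e \<and> e \<noteq> \<one> \<and> I \<subseteq> PIdl e"
  then obtain e where e: "idempotent_elem R e" "e \<noteq> \<one>" "I \<subseteq> PIdl e"
    by blast
  have "\<one> \<ominus> e \<noteq> \<zero>"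
  proof
    have ec: "e \<in> carrier R"
      using e(1) by (simp add: idempotent_elem_def)
    assume "\<one> \<ominus> e = \<zero>"
    moreover have "\<one> = (\<one> \<ominus> e) \<oplus> e"
      using ec by algebra
    ultimately have "\<one> = e"
      using ec by simp
    with e(2) show False
      by simp
  qed
  moreover have "\<one> \<ominus> e \<in> annihilator R I"
    using subset_PIdl_idempotent_iff[OF e(1) assms] e(3) by simp
  ultimately show "annihilator R I \<noteq> {\<zero>}"
    by blast
qed

text \<open>
  An element of \<open>I\<close> that annihilates \<open>I\<close> has square zero, hence the annihilator itself is a witness
  against essentiality unless it is zero.  Conversely, an ideal \<open>J\<close> with \<open>I \<inter> J = 0\<close> annihilates
  \<open>I\<close>, since products of elements of \<open>I\<close> and \<open>J\<close> lie in both.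
\<close>

lemma essential_iff_annihilator_zero:
  assumes "ideal I R"
  shows "essential_ideal R I \<longleftrightarrow> annihilator R I = {\<zero>}"
proof -
  interpret I: ideal I R by (rule assms)
  have sub: "I \<subseteq> carrier R"
    using I.Icarr by blast
  have ann: "ideal (annihilator R I) R"
    by (rule annihilator_ideal[OF sub])
  have disjoint: "I \<inter> annihilator R I = {\<zero>}"
  proof (rule equalityI)
    show "I \<inter> annihilator R I \<subseteq> {\<zero>}"
    proof
      fix x assume x: "x \<in> I \<inter> annihilator R I"
      have "x \<in> carrier R"
        using x sub by blast
      moreover have "x \<otimes> x = \<zero>"
        using x unfolding annihilator_def by blast
      ultimately have "x = \<zero>"
        by (rule square_zero_imp_zero)
      then show "x \<in> {\<zero>}"
        by simp
    qed
    show "{\<zero>} \<subseteq> I \<inter> annihilator R I"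
      using I.zero_closed additive_subgroup.zero_closed[OF ideal.axioms(1)[OF ann]] by blast
  qed
  show ?thesis
  proof
    assume "essential_ideal R I"
    then show "annihilator R I = {\<zero>}"
      using disjoint ann unfolding essential_ideal_def by blast
  next
    assume zero: "annihilator R I = {\<zero>}"
    have "I \<inter> J \<noteq> {\<zero>}" if "ideal J R" "J \<noteq> {\<zero>}" for J
    proof
      interpret J: ideal J R by (rule that(1))
      assume IJ: "I \<inter> J = {\<zero>}"
      have "x \<in> annihilator R I" if "x \<in> J" for x
      proof -
        have "y \<otimes> x \<in> I \<inter> J" if "y \<in> I" for y
          using I.I_r_closed[OF that J.Icarr] J.I_l_closed[OF _ I.Icarr] that \<open>x \<in> J\<close> by simp
        then show ?thesis
          using IJ that J.Icarr by (auto simp: annihilator_def)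
      qed
      then show False
        using zero that(2) J.zero_closed by blast
    qed
    then show "essential_ideal R I"
      using assms by (simp add: essential_ideal_def)
  qed
qed

end

section \<open>Generalized real numbers have idempotent multiples\<close>

lemma not_null_fun_bounded_below:
  assumes "\<not> null_fun x"
  obtains a \<delta> where "\<delta> > 0"
    and "\<exists>\<^sub>F \<epsilon> in at 0 within I01. \<delta> * \<epsilon> powr a \<le> \<bar>x \<epsilon>\<bar>"
proof -
  obtain a where "\<not> ((\<lambda>\<epsilon>. \<bar>x \<epsilon>\<bar> / \<epsilon> powr a) \<longlongrightarrow> 0) (at 0 within I01)"
    using assms unfolding null_fun_def by blast
  then obtain \<delta> where \<delta>: "\<delta> > 0"
      "\<exists>\<^sub>F \<epsilon> in at 0 within I01. \<not> dist (\<bar>x \<epsilon>\<bar> / \<epsilon> powr a) 0 < \<delta>"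
    unfolding tendsto_iff frequently_def by auto
  have "\<forall>\<^sub>F \<epsilon> in at (0::real) within I01. \<epsilon> \<in> I01"
    by (simp add: eventually_at_filter)
  with \<delta>(2) have "\<exists>\<^sub>F \<epsilon> in at 0 within I01. \<epsilon> \<in> I01 \<and> \<not> dist (\<bar>x \<epsilon>\<bar> / \<epsilon> powr a) 0 < \<delta>"
    by (rule frequently_eventually_conj)
  then have "\<exists>\<^sub>F \<epsilon> in at 0 within I01. \<delta> * \<epsilon> powr a \<le> \<bar>x \<epsilon>\<bar>"
    by (rule frequently_elim1) (auto simp: not_less pos_le_divide_eq)
  with \<delta>(1) show thesis
    by (rule that)
qed

lemma moderate_if_bounded:
  assumes "\<And>\<epsilon>. \<epsilon> \<in> I01 \<Longrightarrow> \<bar>y \<epsilon>\<bar> \<le> C * \<epsilon> powr b"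
  shows "moderate y"
  unfolding moderate_def
proof
  \<comment> \<open>One power of \<open>\<epsilon>\<close> is given away to turn boundedness into convergence to \<open>0\<close>.\<close>
  show "((\<lambda>\<epsilon>. \<bar>y \<epsilon>\<bar> / \<epsilon> powr (b - 1)) \<longlongrightarrow> 0) (at 0 within I01)"
  proof (rule null_comparison)
    show "((\<lambda>\<epsilon>. C * \<epsilon> powr 1) \<longlongrightarrow> 0) (at 0 within I01)"
      using tendsto_mult_left[OF powr_tendsto_zero[of 1], of C] by simp
  next
    fix \<epsilon> :: real assume \<epsilon>: "\<epsilon> \<in> I01"
    have "\<bar>y \<epsilon>\<bar> / \<epsilon> powr (b - 1) \<le> C * \<epsilon> powr b / \<epsilon> powr (b - 1)"
      using assms[OF \<epsilon>] by (rule divide_right_mono) simp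
    also have "\<dots> = C * \<epsilon> powr (b - (b - 1))"
      by (simp only: powr_diff times_divide_eq_right)
    finally show "\<bar>\<bar>y \<epsilon>\<bar> / \<epsilon> powr (b - 1)\<bar> \<le> C * \<epsilon> powr 1"
      by simp
  qed
qed

lemma not_null_fun_if_frequently_one:
  assumes "\<exists>\<^sub>F \<epsilon> in at 0 within I01. x \<epsilon> = 1"
  shows "\<not> null_fun x"
proof
  assume "null_fun x"
  then have "((\<lambda>\<epsilon>. \<bar>x \<epsilon>\<bar> / \<epsilon> powr 0) \<longlongrightarrow> 0) (at 0 within I01)"
    unfolding null_fun_def by blast
  then have "\<forall>\<^sub>F \<epsilon> in at 0 within I01. \<bar>x \<epsilon>\<bar> / \<epsilon> powr 0 < 1"
    by (rule order_tendstoD) simp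
  moreover have "\<forall>\<^sub>F \<epsilon> in at (0::real) within I01. \<epsilon> \<in> I01"
    by (simp add: eventually_at_filter)
  ultimately have "\<forall>\<^sub>F \<epsilon> in at 0 within I01. x \<epsilon> \<noteq> 1"
    by eventually_elim auto
  with assms show False
    by (simp add: frequently_def)
qed

text \<open>
  The function \<open>y\<close> is the inverse of \<open>x\<close> where \<open>x\<close> is at least \<open>\<delta> * \<epsilon> powr a\<close> in absolute value, and
  \<open>0\<close> elsewhere; the cut-off is what keeps \<open>y\<close> moderate.
\<close>

lemma moderate_partial_inverse:
  assumes "\<not> null_fun x"
  obtains y where "y \<in> carrier moderate_ring"
    and "\<And>\<epsilon>. \<epsilon> \<in> I01 \<Longrightarrow> y \<epsilon> * x \<epsilon> \<in> {0, 1}"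
    and "\<not> null_fun (\<lambda>\<epsilon>\<in>I01. y \<epsilon> * x \<epsilon>)"
proof -
  obtain a \<delta> where \<delta>: "\<delta> > 0"
    and large: "\<exists>\<^sub>F \<epsilon> in at 0 within I01. \<delta> * \<epsilon> powr a \<le> \<bar>x \<epsilon>\<bar>"
    using not_null_fun_bounded_below[OF assms] .
  define y where "y = (\<lambda>\<epsilon>\<in>I01. if \<delta> * \<epsilon> powr a \<le> \<bar>x \<epsilon>\<bar> then inverse (x \<epsilon>) else 0)"
  have unit: "y \<epsilon> * x \<epsilon> = (if \<delta> * \<epsilon> powr a \<le> \<bar>x \<epsilon>\<bar> then 1 else 0)" if "\<epsilon> \<in> I01" for \<epsilon>
  proof -
    have "0 < \<delta> * \<epsilon> powr a"
      using \<delta> that by simp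
    then show ?thesis
      using that by (auto simp: y_def)
  qed
  have "moderate y"
  proof (rule moderate_if_bounded)
    fix \<epsilon> :: real assume \<epsilon>: "\<epsilon> \<in> I01"
    have pos: "0 < \<delta> * \<epsilon> powr a"
      using \<delta> \<epsilon> by simp
    have "\<bar>y \<epsilon>\<bar> \<le> inverse (\<delta> * \<epsilon> powr a)"
      using \<epsilon> pos less_imp_le[OF positive_imp_inverse_positive[OF pos]] le_imp_inverse_le[OF _ pos, of "\<bar>x \<epsilon>\<bar>"] by (auto simp: y_def simp del: inverse_mult_distrib)
    then show "\<bar>y \<epsilon>\<bar> \<le> inverse \<delta> * \<epsilon> powr (- a)"
      by (simp add: powr_minus)
  qed
  then have "y \<in> carrier moderate_ring"
    by (simp add: moderate_ring_def y_def)
  moreover have "\<not> null_fun (\<lambda>\<epsilon>\<in>I01. y \<epsilon> * x \<epsilon>)"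
  proof (rule not_null_fun_if_frequently_one)
    have "\<forall>\<^sub>F \<epsilon> in at (0::real) within I01. \<epsilon> \<in> I01"
      by (simp add: eventually_at_filter)
    with large have "\<exists>\<^sub>F \<epsilon> in at 0 within I01. \<epsilon> \<in> I01 \<and> \<delta> * \<epsilon> powr a \<le> \<bar>x \<epsilon>\<bar>"
      by (rule frequently_eventually_conj)
    then show "\<exists>\<^sub>F \<epsilon> in at 0 within I01. (\<lambda>\<epsilon>\<in>I01. y \<epsilon> * x \<epsilon>) \<epsilon> = 1"
      by (rule frequently_elim1) (simp add: unit)
  qed
  ultimately show thesis
    using unit by (intro that[of y]) (simp_all del: mult_eq_0_iff)
qed

text \<open>
  The product \<open>e\<close> of the representatives takes only the values \<open>0\<close> and \<open>1\<close>, so it is idempotent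
  already in the ring of moderate functions, and its class is idempotent in the quotient.
\<close>

lemma colombeau_reals_idempotent_multiple:
  assumes "X \<in> carrier colombeau_reals" and "X \<noteq> \<zero>\<^bsub>colombeau_reals\<^esub>"
  shows "\<exists>Y\<in>carrier colombeau_reals.
    idempotent_elem colombeau_reals (Y \<otimes>\<^bsub>colombeau_reals\<^esub> X) \<and>
    Y \<otimes>\<^bsub>colombeau_reals\<^esub> X \<noteq> \<zero>\<^bsub>colombeau_reals\<^esub>"
proof -
  interpret N: ideal null_ideal moderate_ring by (rule ideal_null_ideal)
  let ?M = moderate_ring and ?C = colombeau_reals
  let ?cls = "\<lambda>x. null_ideal +>\<^bsub>?M\<^esub> x"
  have hom: "?cls \<in> ring_hom ?M ?C"
    using N.rcos_ring_hom by (simp add: colombeau_reals_def)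
  have cls_mult: "?cls u \<otimes>\<^bsub>?C\<^esub> ?cls v = ?cls (u \<otimes>\<^bsub>?M\<^esub> v)"
    if "u \<in> carrier ?M" "v \<in> carrier ?M" for u v
    using ring_hom_mult[OF hom that] by simp
  have cls_zero: "?cls u = \<zero>\<^bsub>?C\<^esub> \<longleftrightarrow> null_fun u" if "u \<in> carrier ?M" for u
  proof -
    have "?cls u = null_ideal \<longleftrightarrow> u \<in> null_ideal"
      using that N.a_coset_join1[OF _ that N.a_subgroup] N.a_coset_join2[OF that N.a_subgroup]
      by blast
    then show ?thesis
      using that by (simp add: colombeau_reals_def FactRing_def null_ideal_def moderate_ring_def)
  qed
  obtain x where x: "x \<in> carrier ?M" "X = ?cls x"
    using assms(1) by (auto simp: colombeau_reals_def FactRing_def A_RCOSETS_def')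
  then have "\<not> null_fun x"
    using assms(2) cls_zero by blast
  then obtain y where y: "y \<in> carrier ?M"
    and idem: "\<And>\<epsilon>. \<epsilon> \<in> I01 \<Longrightarrow> y \<epsilon> * x \<epsilon> \<in> {0, 1}"
    and nz: "\<not> null_fun (\<lambda>\<epsilon>\<in>I01. y \<epsilon> * x \<epsilon>)"
    using moderate_partial_inverse by blast
  define e where "e = y \<otimes>\<^bsub>?M\<^esub> x"
  have e: "e \<in> carrier ?M"
    using x y by (simp add: e_def)
  have YX: "?cls y \<otimes>\<^bsub>?C\<^esub> X = ?cls e"
    using cls_mult x y by (simp add: e_def)
  have e_fun: "e = (\<lambda>\<epsilon>\<in>I01. y \<epsilon> * x \<epsilon>)"
    by (simp add: e_def moderate_ring_def)
  have "e \<otimes>\<^bsub>?M\<^esub> e = e"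
  proof -
    have "(y \<epsilon> * x \<epsilon>) * (y \<epsilon> * x \<epsilon>) = y \<epsilon> * x \<epsilon>" if "\<epsilon> \<in> I01" for \<epsilon>
      using idem[of \<epsilon>] that by auto
    then show ?thesis
      unfolding e_fun by (auto simp: moderate_ring_def restrict_def)
  qed
  then have "idempotent_elem ?C (?cls e)"
    using cls_mult[OF e e] ring_hom_closed[OF hom e] by (simp add: idempotent_elem_def)
  moreover have "?cls e \<noteq> \<zero>\<^bsub>?C\<^esub>"
    using cls_zero[OF e] nz e_fun by simp
  ultimately show ?thesis
    using ring_hom_closed[OF hom y] YX by metis
qed

section \<open>Annihilators and essential ideals of the generalized real numbers\<close>

theorem lemma4p6:
  fixes I :: "(real \<Rightarrow> real) set set"
  assumes "ideal I colombeau_reals"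
  shows "(annihilator colombeau_reals I \<noteq> {\<zero>\<^bsub>colombeau_reals\<^esub>} \<longleftrightarrow>
           (\<exists>e. idempotent_elem colombeau_reals e \<and> e \<noteq> \<one>\<^bsub>colombeau_reals\<^esub> \<and>
                I \<subseteq> PIdl\<^bsub>colombeau_reals\<^esub> e)) \<and>
         (essential_ideal colombeau_reals I \<longleftrightarrow>
           \<not> (\<exists>e. idempotent_elem colombeau_reals e \<and> e \<noteq> \<one>\<^bsub>colombeau_reals\<^esub> \<and>
                  I \<subseteq> PIdl\<^bsub>colombeau_reals\<^esub> e)) \<and>
         (annihilator colombeau_reals I \<noteq> {\<zero>\<^bsub>colombeau_reals\<^esub>} \<longrightarrow>
           (\<exists>e \<in> annihilator colombeau_reals I.
              idempotent_elem colombeau_reals e \<and> e \<noteq> \<zero>\<^bsub>colombeau_reals\<^esub>))"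
proof -
  let ?C = colombeau_reals
  let ?P = "\<exists>e. idempotent_elem ?C e \<and> e \<noteq> \<one>\<^bsub>?C\<^esub> \<and> I \<subseteq> PIdl\<^bsub>?C\<^esub> e"
  have "idempotent_multiple_cring_axioms ?C"
    by (rule idempotent_multiple_cring_axioms.intro) (rule colombeau_reals_idempotent_multiple)
  then interpret idempotent_multiple_cring ?C
    by (rule idempotent_multiple_cring.intro[OF cring_colombeau_reals])
  have sub: "I \<subseteq> carrier colombeau_reals"
    using ideal.Icarr[OF assms] by blast
  show ?thesis
  proof (intro conjI impI)
    show "annihilator ?C I \<noteq> {\<zero>\<^bsub>?C\<^esub>} \<longleftrightarrow> ?P"
      by (rule annihilator_nonzero_iff[OF sub])
    then show "essential_ideal ?C I \<longleftrightarrow> \<not> ?P"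
      using essential_iff_annihilator_zero[OF assms] by argo
  qed (rule annihilator_contains_idempotent[OF sub])
qed

end
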